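(* Let $n$ be a positive integer such that $\sigma(n)=\sigma(n+1)$ and this common value is odd, where $\sigma(m)$ denotes the sum of the positive divisors of $m$. Then there exist integers $x,y$ such that either $n=2y^2$, $n+1=x^2$ and $x^2-2y^2=1$, or $n=x^2$, $n+1=2y^2$ and $x^2-2y^2=-1$.
   Context: $\sigma(m)=\sum_{d\mid m,\ d>0} d$ is the sum of the positive divisors of $m$. *)

theory Defs
  imports Main
begin

text \<open>Intended for \<open>m > 0\<close>; at \<open>m = 0\<close> the index set is infinite and the sum is \<open>0\<close>.\<close>

definition divisor_sigma :: "nat \<Rightarrow> nat" where
  "divisor_sigma m = (\<Sum>d | d dvd m \<and> d > 0. d)"

end

theory Submission
  imports Defs
begin

text \<open>
  Modulo 2, \<open>\<sigma>(n)\<close> counts the odd divisors of \<open>n\<close>, that is, the divisors of its odd part \<open>m\<close>.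
  Pairing \<open>d\<close> with \<open>m/d\<close> shows that their number is odd only if \<open>m\<close> is a square, so that \<open>n\<close> is
  a square or twice a square. Two consecutive positive integers are neither both squares nor
  both twice squares.
\<close>

lemma even_card_divisors:
  fixes m :: nat
  assumes "m > 0" and nonsquare: "\<And>y. m \<noteq> y\<^sup>2"
  shows "even (card {d. d dvd m})"
proof -
  let ?A = "{d. d dvd m \<and> d < m div d}" and ?B = "{d. d dvd m \<and> m div d < d}"
  \<comment> \<open>A fixed point of the pairing would give m = d^2. So every divisor lies in
    exactly one of \<open>?A\<close> and \<open>?B\<close>, and the involution swaps these two
    sets.\<close>
  have "d \<noteq> m div d" if "d dvd m" for d
    using that nonsquare[of d] by (metis dvd_mult_div_cancel power2_eq_square)
  then have split: "{d. d dvd m} = ?A \<union> ?B"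
    by (auto simp: neq_iff)
  have "bij_betw (\<lambda>d. m div d) ?A ?B"
    by (rule bij_betw_byWitness[where f' = "\<lambda>d. m div d"])
      (use \<open>m > 0\<close> in \<open>auto simp: div_div_eq_right\<close>)
  then have "card ?A = card ?B"
    by (rule bij_betw_same_card)
  moreover have "card {d. d dvd m} = card ?A + card ?B"
    unfolding split using \<open>m > 0\<close> by (intro card_Un_disjoint) auto
  ultimately show ?thesis
    by simp
qed

text \<open>Induction by halving: removing a factor 2 leaves the set of odd divisors unchanged, and
  putting it back merely exchanges the two shapes, as 2 * (2 * y^2) = (2 * y)^2. An odd n has only
  odd divisors, so there the pairing argument applies.\<close>

lemma square_or_double_square_if_odd_card_odd_divisors:
  fixes n :: nat
  assumes "n > 0" and "odd (card {d. d dvd n \<and> odd d})"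
  shows "\<exists>y. n = y\<^sup>2 \<or> n = 2 * y\<^sup>2"
  using assms
proof (induction n rule: less_induct)
  case (less n)
  show ?case
  proof (cases "even n")
    case True
    then obtain j where j: "n = 2 * j" ..
    have "{d. d dvd n \<and> odd d} = {d. d dvd j \<and> odd d}"
      unfolding j by (auto simp: coprime_dvd_mult_right_iff)
    then obtain y where "j = y\<^sup>2 \<or> j = 2 * y\<^sup>2"
      using less.IH[of j] less.prems j by auto
    then have "n = 2 * y\<^sup>2 \<or> n = (2 * y)\<^sup>2"
      using j by (auto simp: power_mult_distrib)
    then show ?thesis
      by blast
  next
    case False
    then have "{d. d dvd n \<and> odd d} = {d. d dvd n}"
      using dvd_trans by blast
    then show ?thesis
      using even_card_divisors less.prems by metis
  qed
qed

lemma square_or_double_square_if_odd_divisor_sigma: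
  assumes "n > 0" and "odd (divisor_sigma n)"
  shows "\<exists>y. n = y\<^sup>2 \<or> n = 2 * y\<^sup>2"
proof (rule square_or_double_square_if_odd_card_odd_divisors)
  \<comment> \<open>A finite sum has the parity of the number of its odd terms.\<close>
  have "{d \<in> {d. d dvd n \<and> d > 0}. odd d} = {d. d dvd n \<and> odd d}"
    using \<open>n > 0\<close> by (auto intro: odd_pos)
  then show "odd (card {d. d dvd n \<and> odd d})"
    using assms even_sum_iff[of "{d. d dvd n \<and> d > 0}" "\<lambda>d. d"]
    by (simp add: divisor_sigma_def)
qed (fact \<open>n > 0\<close>)

text \<open>The next square after a^2 is a^2 + 2 * a + 1, which exceeds a^2 + 1 as soon as a >
  0.\<close>

lemma Suc_square_not_square:
  fixes a b :: nat
  assumes "a > 0"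
  shows "a\<^sup>2 + 1 \<noteq> b\<^sup>2"
proof
  assume *: "a\<^sup>2 + 1 = b\<^sup>2"
  then have "a\<^sup>2 < b\<^sup>2" by simp
  then have "Suc a \<le> b"
    by (simp add: power_less_imp_less_base Suc_leI)
  then have "(Suc a)\<^sup>2 \<le> b\<^sup>2"
    by (rule power_mono) simp
  then show False
    using * \<open>a > 0\<close> by (simp add: power2_eq_square)
qed

theorem theorem3:
  fixes n :: nat
  assumes "n > 0"
    and "divisor_sigma n = divisor_sigma (n + 1)"
    and "odd (divisor_sigma n)"
  shows "\<exists>x y :: int.
           (int n = 2 * y\<^sup>2 \<and> int (n + 1) = x\<^sup>2 \<and> x\<^sup>2 - 2 * y\<^sup>2 = 1) \<or>
           (int n = x\<^sup>2 \<and> int (n + 1) = 2 * y\<^sup>2 \<and> x\<^sup>2 - 2 * y\<^sup>2 = -1)"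
proof -
  obtain a where a: "n = a\<^sup>2 \<or> n = 2 * a\<^sup>2"
    using square_or_double_square_if_odd_divisor_sigma assms(1,3) by blast
  \<comment> \<open>The equality of the two sigma values carries oddness over to n + 1.\<close>
  obtain b where b: "n + 1 = b\<^sup>2 \<or> n + 1 = 2 * b\<^sup>2"
    using square_or_double_square_if_odd_divisor_sigma[of "n + 1"] assms by auto
  have "\<not> (n = a\<^sup>2 \<and> n + 1 = b\<^sup>2)"
    using Suc_square_not_square[of a b] \<open>n > 0\<close> by auto
  moreover have "\<not> (n = 2 * a\<^sup>2 \<and> n + 1 = 2 * b\<^sup>2)"
    by presburger
  \<comment> \<open>In either mixed case the Pell equation is the difference of n and n + 1, its
    sign depending on which of them is the square.\<close>
  ultimately consider "n = 2 * a\<^sup>2" "n + 1 = b\<^sup>2" | "n = a\<^sup>2" "n + 1 = 2 * b\<^sup>2"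
    using a b by blast
  then show ?thesis
  proof cases
    case 1
    then have "int n = 2 * (int a)\<^sup>2" "int (n + 1) = (int b)\<^sup>2"
      by simp_all
    then show ?thesis
      by (intro exI[of _ "int b"] exI[of _ "int a"]) simp
  next
    case 2
    then have "int n = (int a)\<^sup>2" "int (n + 1) = 2 * (int b)\<^sup>2"
      by simp_all
    then show ?thesis
      by (intro exI[of _ "int a"] exI[of _ "int b"]) simp
  qed
qed

end
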